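(* Let $p\ge 1$ and $0<\alpha<2$. The following properties hold. (1) For all $\mathbb{R}^p$-valued random vectors $X,Y$, $\mathrm{siCov}^{(\alpha)}(X,Y)\ge 0$, and $\mathrm{siCov}^{(\alpha)}(X,Y)=0$ if and only if $X$ and $Y$ are sub-independent. (2) For all $\mathbb{R}^p$-valued random vectors $X$, $\mathrm{siCov}^{(\alpha)}(X)=0$ if and only if $X=E(X)$ almost surely. (3) For all constant vectors $a_1,a_2\in\mathbb{R}^p$, every scalar $b$ and every $p\times p$ orthonormal matrix $C$, $$\mathrm{siCov}^{(\alpha)}(a_1+bCX,\;a_2+bCY)=|b|\,\mathrm{siCov}^{(\alpha)}(X,Y).$$ (4) For every constant vector $a\in\mathbb{R}^p$, every scalar $b$ and every $p\times p$ orthonormal matrix $C$, $$\mathrm{siCov}^{(\alpha)}(a+bCX)=|b|\,\mathrm{siCov}^{(\alpha)}(X).$$ (5) If $X$ and $Y$ are sub-independent, then for any $\beta\in(0,2)$ such that $E(|X|^{\beta}+|Y|^{\beta})<\infty$, one has $\mathrm{siCov}^{(\beta)}(X,Y)=0$. Conversely, if $\mathrm{siCov}^{(\beta)}(X,Y)=0$ for some $\beta\in(0,2)$, then $X$ and $Y$ are sub-independent.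
   Context: $|\cdot|$ denotes the Euclidean norm on $\mathbb{R}^p$ (and the modulus for complex numbers), and $\langle\cdot,\cdot\rangle$ the Euclidean scalar product. $X,Y$ denote $\mathbb{R}^p$-valued random vectors on a common probability space; $\phi_{X,Y}(s,t)=E\,e^{i\langle s,X\rangle+i\langle t,Y\rangle}$ is their joint characteristic function, and $\phi_X(t)=E\,e^{i\langle t,X\rangle}$, $\phi_Y(t)=E\,e^{i\langle t,Y\rangle}$. $X$ and $Y$ are called sub-independent if $\phi_{X,Y}(t,t)=\phi_X(t)\phi_Y(t)$ for all $t\in\mathbb{R}^p$ (equivalently, the law of $X+Y$ is the convolution of the laws of $X$ and $Y$). For $0<\alpha<2$, the $\alpha$-sub-independent covariance is $$\mathrm{siCov}^{(\alpha)}(X,Y)=\int_{\mathbb{R}^p}\bigl|\phi_{X,Y}(t,t)-\phi_X(t)\phi_Y(t)\bigr|^2\rho_\alpha(t)\,dt,\qquad \rho_\alpha(t)=\frac{1}{c(p,\alpha)\,|t|^{\alpha+p}},$$ $$c(p,\alpha)=\frac{2\pi^{p/2}\Gamma(1-\alpha/2)}{\alpha\,2^{\alpha}\,\Gamma((\alpha+p)/2)},$$ and $\mathrm{siCov}^{(\alpha)}(X)=\mathrm{siCov}^{(\alpha)}(X,X)$. A $p\times p$ real matrix $C$ is orthonormal if $C^{T}C=I_p$.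
   Formalization: In (3) and (4) the factor |b| is corrected to |b|^α (the printed factor fails for α≠1, e.g. for Bernoulli X=Y); in (2) X is assumed integrable so that E(X) exists (a standard Cauchy X has siCov(X)=0 without being constant). *)

theory Defs
  imports "HOL-Probability.Probability"
begin

definition joint_cf ::
  "'a measure \<Rightarrow> ('a \<Rightarrow> real^'n) \<Rightarrow> ('a \<Rightarrow> real^'n) \<Rightarrow> real^'n \<Rightarrow> real^'n \<Rightarrow> complex"
  where "joint_cf M X Y s t =
    (LINT \<omega>|M. exp (\<i> * complex_of_real (s \<bullet> X \<omega>) + \<i> * complex_of_real (t \<bullet> Y \<omega>)))"

definition cf :: "'a measure \<Rightarrow> ('a \<Rightarrow> real^'n) \<Rightarrow> real^'n \<Rightarrow> complex"
  where "cf M X t = (LINT \<omega>|M. exp (\<i> * complex_of_real (t \<bullet> X \<omega>)))"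

definition sub_independent ::
  "'a measure \<Rightarrow> ('a \<Rightarrow> real^'n) \<Rightarrow> ('a \<Rightarrow> real^'n) \<Rightarrow> bool"
  where "sub_independent M X Y \<longleftrightarrow> (\<forall>t. joint_cf M X Y t t = cf M X t * cf M Y t)"

definition weight_const :: "nat \<Rightarrow> real \<Rightarrow> real"
  where "weight_const p \<alpha> =
    2 * pi powr (real p / 2) * Gamma (1 - \<alpha> / 2) /
      (\<alpha> * 2 powr \<alpha> * Gamma ((\<alpha> + real p) / 2))"

definition weight :: "real \<Rightarrow> real^'n \<Rightarrow> real"
  where "weight \<alpha> t = 1 / (weight_const CARD('n) \<alpha> * norm t powr (\<alpha> + real CARD('n)))"

text \<open>
  The integral is a Lebesgue integral with values in $[0,\infty]$: without moment assumptions
  it may diverge at the origin, and the Bochner integral would then be $0$ by convention.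
  The integrand is a nonnegative real number (see \<open>weight_nonneg\<close> below), so the truncation
  of negative numbers performed by \<open>ennreal\<close> plays no role.
\<close>

definition siCov ::
  "'a measure \<Rightarrow> real \<Rightarrow> ('a \<Rightarrow> real^'n) \<Rightarrow> ('a \<Rightarrow> real^'n) \<Rightarrow> ennreal"
  where "siCov M \<alpha> X Y =
    (\<integral>\<^sup>+ t. ennreal ((cmod (joint_cf M X Y t t - cf M X t * cf M Y t))\<^sup>2 * weight \<alpha> t) \<partial>lborel)"

definition siCov_self :: "'a measure \<Rightarrow> real \<Rightarrow> ('a \<Rightarrow> real^'n) \<Rightarrow> ennreal"
  where "siCov_self M \<alpha> X = siCov M \<alpha> X X"

lemma weight_const_pos:
  assumes "0 < \<alpha>" "\<alpha> < 2"
  shows "0 < weight_const p \<alpha>"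
proof -
  have "0 < Gamma (1 - \<alpha> / 2)" "0 < Gamma ((\<alpha> + real p) / 2)"
    using assms by (auto intro!: Gamma_real_pos)
  then show ?thesis
    using assms by (simp add: weight_const_def)
qed

lemma weight_nonneg:
  assumes "0 < \<alpha>" "\<alpha> < 2"
  shows "0 \<le> weight \<alpha> t"
  using weight_const_pos[OF assms] by (simp add: weight_def less_imp_le)

end

theory Submission imports Defs begin

section \<open>Changes of variables and null sets for Lebesgue measure\<close>

lemma inner_matrix_vector_mult_transpose:
  fixes C :: "real^'n^'n"
  shows "t \<bullet> (C *v x) = (transpose C *v t) \<bullet> x"
  by (simp add: dot_lmul_matrix)

lemma nn_integral_lborel_shift:
  fixes g :: "'a::euclidean_space \<Rightarrow> ennreal"
  assumes [measurable]: "g \<in> borel_measurable borel"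
  shows "(\<integral>\<^sup>+x. g (c + x) \<partial>lborel) = (\<integral>\<^sup>+x. g x \<partial>lborel)"
proof -
  have "(\<integral>\<^sup>+x. g x \<partial>lborel) = (\<integral>\<^sup>+x. g x \<partial>distr lborel borel ((+) c))"
    by (simp add: lborel_distr_plus)
  also have "\<dots> = (\<integral>\<^sup>+x. g (c + x) \<partial>lborel)"
    by (subst nn_integral_distr) auto
  finally show ?thesis by simp
qed

text \<open>Haar's uniqueness argument: both sides are compared with the same double integral
  against the indicator of the unit ball, which \<open>f\<close> preserves. The library's change of
  variables only covers index types of class \<open>wellorder\<close>.\<close>
lemma nn_integral_lborel_orthogonal:
  fixes g :: "'a::euclidean_space \<Rightarrow> ennreal" and f :: "'a \<Rightarrow> 'a"
  assumes g [measurable]: "g \<in> borel_measurable borel"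
    and f: "orthogonal_transformation f"
  shows "(\<integral>\<^sup>+x. g (f x) \<partial>lborel) = (\<integral>\<^sup>+x. g x \<partial>lborel)"
proof -
  define h where "h = (indicator (ball 0 1) :: 'a \<Rightarrow> ennreal)"
  define B where "B = emeasure lborel (ball (0::'a) 1)"
  have lin: "linear f"
    using f by (rule orthogonal_transformation_linear)
  have [measurable]: "f \<in> borel_measurable borel"
    using lin by (intro borel_measurable_continuous_onI linear_continuous_on)
      (simp add: linear_conv_bounded_linear)
  have [measurable]: "h \<in> borel_measurable borel"
    unfolding h_def by (intro borel_measurable_indicator) simp
  have hB: "(\<integral>\<^sup>+x. h x \<partial>lborel) = B"
    by (simp add: h_def B_def)
  have hf: "h (- f y) = h y" for y
    using orthogonal_transformation_norm[OF f, of y] by (simp add: h_def indicator_def)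
  have B0: "B \<noteq> 0"
    using open_not_negligible[of "ball (0::'a) 1"]
    by (auto simp: B_def negligible_iff_null_sets null_sets_def)
  have Binf: "B \<noteq> \<infinity>"
    using emeasure_lborel_ball_finite[of "0::'a" 1] by (auto simp: B_def)
  have "(\<integral>\<^sup>+y. g (f y) \<partial>lborel) * B = (\<integral>\<^sup>+y. g (f y) * B \<partial>lborel)"
    by (subst nn_integral_multc) auto
  \<comment> \<open>By translation invariance every translate of \<open>h\<close> has integral
    \<open>B\<close>, so the constant may be replaced by the integral of a translate depending on
    \<open>y\<close>.\<close>
  also have "\<dots> = (\<integral>\<^sup>+y. (\<integral>\<^sup>+x. g (f y) * h (- f y + x) \<partial>lborel) \<partial>lborel)"
    by (intro nn_integral_cong, subst nn_integral_cmult) (auto simp: nn_integral_lborel_shift hB simp del: uminus_add_conv_diff)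
  also have "\<dots> = (\<integral>\<^sup>+x. (\<integral>\<^sup>+y. g (f y) * h (- f y + x) \<partial>lborel) \<partial>lborel)"
    by (rule lborel_pair.Fubini') measurable
  also have "\<dots> = (\<integral>\<^sup>+x. (\<integral>\<^sup>+y. g (x + f y) * h (- f y) \<partial>lborel) \<partial>lborel)"
  proof (rule nn_integral_cong)
    fix x :: 'a
    \<comment> \<open>Substituting \<open>z + y\<close> for \<open>y\<close> turns
      \<open>f y\<close> into \<open>x + f y\<close> by linearity, which moves \<open>x\<close> from
      the argument of \<open>h\<close> into that of \<open>g\<close>.\<close>
    obtain z where z: "x = f z"
      using orthogonal_transformation_surj[OF f] by (metis surjD)
    have "(\<integral>\<^sup>+y. g (f y) * h (- f y + x) \<partial>lborel)
        = (\<integral>\<^sup>+y. g (f (z + y)) * h (- f (z + y) + x) \<partial>lborel)"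
      by (rule nn_integral_lborel_shift[symmetric]) measurable
    also have "\<dots> = (\<integral>\<^sup>+y. g (x + f y) * h (- f y) \<partial>lborel)"
      by (simp add: z linear_add[OF lin])
    finally show "(\<integral>\<^sup>+y. g (f y) * h (- f y + x) \<partial>lborel)
        = (\<integral>\<^sup>+y. g (x + f y) * h (- f y) \<partial>lborel)" .
  qed
  also have "\<dots> = (\<integral>\<^sup>+y. (\<integral>\<^sup>+x. g (x + f y) * h (- f y) \<partial>lborel) \<partial>lborel)"
    by (rule lborel_pair.Fubini') measurable
  also have "\<dots> = (\<integral>\<^sup>+y. (\<integral>\<^sup>+x. g x \<partial>lborel) * h y \<partial>lborel)"
    by (intro nn_integral_cong, subst nn_integral_multc)
      (auto simp: nn_integral_lborel_shift add.commute[of _ "f _"] hf)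
  also have "\<dots> = (\<integral>\<^sup>+x. g x \<partial>lborel) * B"
    by (subst nn_integral_cmult) (auto simp: hB)
  finally show ?thesis
    using B0 Binf by (simp add: ennreal_mult_cancel_left mult.commute[of _ B])
qed

lemma nn_integral_lborel_scaleR:
  fixes g :: "'a::euclidean_space \<Rightarrow> ennreal"
  assumes [measurable]: "g \<in> borel_measurable borel" and "b \<noteq> 0"
  shows "(\<integral>\<^sup>+x. g x \<partial>lborel) = ennreal (\<bar>b\<bar> ^ DIM('a)) * (\<integral>\<^sup>+x. g (b *\<^sub>R x) \<partial>lborel)"
  by (subst lborel_affine[OF \<open>b \<noteq> 0\<close>, of 0])
    (simp add: nn_integral_density nn_integral_distr nn_integral_cmult)

text \<open>The set where a continuous function does not vanish is open, and a nonempty open set is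
  never Lebesgue null.\<close>

lemma AE_lborel_zero_imp_zero:
  fixes g :: "'a::euclidean_space \<Rightarrow> 'b::{t2_space, zero}"
  assumes g: "continuous_on UNIV g" and AE: "AE x in lborel. g x = 0"
  shows "g x = 0"
proof -
  let ?U = "{x. g x \<noteq> 0}"
  have "open ?U"
    using g by (intro open_Collect_neq) auto
  moreover have "?U \<in> null_sets lborel"
    using AE \<open>open ?U\<close> by (subst AE_iff_null_sets) auto
  then have "negligible ?U"
    by (simp add: negligible_iff_null_sets null_sets_completionI)
  ultimately show ?thesis
    using open_not_negligible[of ?U] by auto
qed

section \<open>Basic properties of characteristic functions\<close>

context prob_space
begin

lemma integrable_cis_inner:
  fixes X :: "'a \<Rightarrow> real^'n"
  assumes [measurable]: "X \<in> borel_measurable M"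
  shows "integrable M (\<lambda>\<omega>. exp (\<i> * complex_of_real (t \<bullet> X \<omega>)))"
  by (rule integrable_const_bound[where B=1]) auto

text \<open>Dominated convergence along sequences, with the constant 1 as majorant because the
  integrand has modulus 1.\<close>

lemma continuous_on_cf:
  fixes X :: "'a \<Rightarrow> real^'n"
  assumes [measurable]: "X \<in> borel_measurable M"
  shows "continuous_on UNIV (cf M X)"
  unfolding continuous_on_sequentially comp_def cf_def
proof safe
  fix u :: "nat \<Rightarrow> real^'n" and t
  assume u: "u \<longlonglongrightarrow> t"
  show "(\<lambda>n. LINT \<omega>|M. exp (\<i> * complex_of_real (u n \<bullet> X \<omega>)))
      \<longlonglongrightarrow> (LINT \<omega>|M. exp (\<i> * complex_of_real (t \<bullet> X \<omega>)))"
    by (rule integral_dominated_convergence[where w="\<lambda>_. 1"]) (auto intro!: tendsto_intros u)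
qed

lemma norm_cf_le_1:
  fixes X :: "'a \<Rightarrow> real^'n"
  assumes [measurable]: "X \<in> borel_measurable M"
  shows "cmod (cf M X t) \<le> 1"
proof -
  have "cmod (cf M X t) \<le> (LINT \<omega>|M. cmod (exp (\<i> * complex_of_real (t \<bullet> X \<omega>))))"
    unfolding cf_def by (rule integral_norm_bound)
  then show ?thesis
    by (simp add: prob_space)
qed

text \<open>Reduces the diagonal to an ordinary characteristic function, so that continuity and the
  affine rule for \<open>cf\<close> apply to it as well.\<close>

lemma joint_cf_diagonal: "joint_cf M X Y t t = cf M (\<lambda>\<omega>. X \<omega> + Y \<omega>) t"
  by (simp add: joint_cf_def cf_def inner_add_right distrib_left)

lemma cf_affine:
  fixes X :: "'a \<Rightarrow> real^'n" and C :: "real^'n^'n"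
  shows "cf M (\<lambda>\<omega>. a + b *\<^sub>R (C *v X \<omega>)) t
    = exp (\<i> * complex_of_real (t \<bullet> a)) * cf M X (b *\<^sub>R (transpose C *v t))"
  by (simp add: cf_def inner_add_right inner_matrix_vector_mult_transpose distrib_left exp_add)

section \<open>Vanishing and affine scaling of \<open>siCov\<close>\<close>

text \<open>The weight is positive off the origin, so a zero integral makes the difference of
  characteristic functions vanish almost everywhere, and continuity extends this to every point. The
  right-hand side does not mention \<open>\<alpha>\<close>, so vanishing transfers between
  exponents.\<close>

lemma sub_independent_iff_siCov_eq_0:
  fixes X Y :: "'a \<Rightarrow> real^'n"
  assumes [measurable]: "X \<in> borel_measurable M" "Y \<in> borel_measurable M"
    and \<alpha>: "0 < \<alpha>" "\<alpha> < 2"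
  shows "siCov M \<alpha> X Y = 0 \<longleftrightarrow> sub_independent M X Y"
proof
  assume "sub_independent M X Y"
  then show "siCov M \<alpha> X Y = 0"
    by (simp add: siCov_def sub_independent_def)
next
  define D where "D t = joint_cf M X Y t t - cf M X t * cf M Y t" for t
  have D: "continuous_on UNIV D"
    unfolding D_def by (subst joint_cf_diagonal, intro continuous_intros continuous_on_cf) auto
  have [measurable]: "D \<in> borel_measurable borel"
    using D by (rule borel_measurable_continuous_onI)
  assume "siCov M \<alpha> X Y = 0"
  then have "AE t in lborel. ennreal ((cmod (D t))\<^sup>2 * weight \<alpha> t) = 0"
    unfolding siCov_def D_def[symmetric]
    by (subst (asm) nn_integral_0_iff_AE) (auto simp: weight_def)
  \<comment> \<open>At the origin the weight is 0, since division by zero yields 0, so the integrand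
    says nothing about \<open>D 0\<close>; the origin is a null set.\<close>
  moreover have "AE t in lborel. (t :: real^'n) \<noteq> 0"
    by (rule AE_lborel_singleton)
  ultimately have "AE t in lborel. D t = 0"
  proof eventually_elim
    case (elim t)
    have "0 < weight \<alpha> t"
      using elim weight_const_pos[OF \<alpha>] by (simp add: weight_def)
    with elim show ?case
      by (simp add: ennreal_eq_0_iff mult_le_0_iff)
  qed
  then show "sub_independent M X Y"
    using AE_lborel_zero_imp_zero[OF D] by (simp add: sub_independent_def D_def)
qed

text \<open>Shifts contribute only phases of modulus 1, and the orthogonal part preserves both the
  norm and Lebesgue measure. Scaling by a nonzero \<open>b\<close> gives
  \<open>\<bar>b\<bar>\<close> to the power \<open>\<alpha> + p\<close> from the weight,
  \<open>p\<close> being the dimension; the Jacobian absorbs the power \<open>p\<close>.\<close>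

lemma siCov_affine:
  fixes X Y :: "'a \<Rightarrow> real^'n" and C :: "real^'n^'n"
  assumes [measurable]: "X \<in> borel_measurable M" "Y \<in> borel_measurable M"
    and C: "transpose C ** C = mat 1" and \<alpha>: "0 < \<alpha>" "\<alpha> < 2"
  shows "siCov M \<alpha> (\<lambda>\<omega>. a1 + b *\<^sub>R (C *v X \<omega>)) (\<lambda>\<omega>. a2 + b *\<^sub>R (C *v Y \<omega>))
    = ennreal (\<bar>b\<bar> powr \<alpha>) * siCov M \<alpha> X Y"
proof -
  let ?X = "\<lambda>\<omega>. a1 + b *\<^sub>R (C *v X \<omega>)" and ?Y = "\<lambda>\<omega>. a2 + b *\<^sub>R (C *v Y \<omega>)"
  define D where "D t = joint_cf M X Y t t - cf M X t * cf M Y t" for t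
  define f where "f t = transpose C *v t" for t
  have "(\<lambda>\<omega>. ?X \<omega> + ?Y \<omega>) = (\<lambda>\<omega>. (a1 + a2) + b *\<^sub>R (C *v (X \<omega> + Y \<omega>)))"
    by (simp add: matrix_vector_right_distrib scaleR_right_distrib algebra_simps)
  \<comment> \<open>The joint term and the product carry the same phase, that of
    \<open>a1 + a2\<close>, so it factors out of the difference.\<close>
  then have "joint_cf M ?X ?Y t t - cf M ?X t * cf M ?Y t
      = exp (\<i> * complex_of_real (t \<bullet> (a1 + a2))) * D (b *\<^sub>R f t)" for t
    unfolding joint_cf_diagonal D_def f_def
    by (simp only: cf_affine) (simp add: inner_add_right distrib_left exp_add algebra_simps)
  then have lhs: "siCov M \<alpha> ?X ?Y
      = (\<integral>\<^sup>+t. ennreal ((cmod (D (b *\<^sub>R f t)))\<^sup>2 * weight \<alpha> t) \<partial>lborel)"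
    by (simp add: siCov_def norm_mult)
  show ?thesis
  proof (cases "b = 0")
    case True
    \<comment> \<open>For \<open>b = 0\<close> the left integrand is a multiple of the squared
      modulus of \<open>D 0\<close>. The right side is 0 as well, even if
      \<open>siCov M \<alpha> X Y\<close> is infinite, because \<open>0 * \<infinity> = 0\<close> in
      \<open>ennreal\<close>.\<close>
    have "D 0 = 0"
      by (simp add: D_def joint_cf_diagonal cf_def prob_space)
    with True show ?thesis
      unfolding lhs by simp
  next
    case b: False
    have D: "continuous_on UNIV D"
      unfolding D_def by (subst joint_cf_diagonal, intro continuous_intros continuous_on_cf) auto
    have [measurable]: "D \<in> borel_measurable borel"
      using D by (rule borel_measurable_continuous_onI)
    define G where "G t = ennreal ((cmod (D t))\<^sup>2 * weight \<alpha> t)" for t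
    have [measurable]: "G \<in> borel_measurable borel"
      unfolding G_def weight_def by measurable
    \<comment> \<open>Since \<open>f\<close> multiplies by the transpose, the one-sided hypothesis
      on \<open>C\<close> has to be turned around: a left inverse of a square matrix is also a right
      inverse.\<close>
    have f: "orthogonal_transformation f"
      using C unfolding f_def orthogonal_transformation_matrix
      by (simp add: orthogonal_matrix_def matrix_left_right_inverse del: transpose_matrix_vector)
    have [measurable]: "f \<in> borel_measurable borel"
      using orthogonal_transformation_linear[OF f]
      by (intro borel_measurable_continuous_onI linear_continuous_on)
        (simp add: linear_conv_bounded_linear)
    have w: "weight \<alpha> t = \<bar>b\<bar> powr (\<alpha> + CARD('n)) * weight \<alpha> (b *\<^sub>R f t)" for t
      using b orthogonal_transformation_norm[OF f, of t]
      by (simp add: weight_def powr_mult)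
    have "siCov M \<alpha> ?X ?Y = (\<integral>\<^sup>+t. ennreal (\<bar>b\<bar> powr (\<alpha> + CARD('n))) * G (b *\<^sub>R f t) \<partial>lborel)"
      unfolding lhs G_def by (subst w) (simp add: ennreal_mult'[symmetric] algebra_simps)
    also have "\<dots> = ennreal (\<bar>b\<bar> powr (\<alpha> + CARD('n))) * (\<integral>\<^sup>+t. G (b *\<^sub>R t) \<partial>lborel)"
      using nn_integral_lborel_orthogonal[OF _ f, of "\<lambda>t. G (b *\<^sub>R t)"]
      by (subst nn_integral_cmult) auto
    also have "\<dots> = ennreal (\<bar>b\<bar> powr \<alpha>) * (ennreal (\<bar>b\<bar> ^ DIM(real^'n)) * (\<integral>\<^sup>+t. G (b *\<^sub>R t) \<partial>lborel))"
      using b by (simp add: powr_add powr_realpow ennreal_mult mult.assoc)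
    also have "\<dots> = ennreal (\<bar>b\<bar> powr \<alpha>) * siCov M \<alpha> X Y"
      using nn_integral_lborel_scaleR[OF \<open>G \<in> _\<close> b] by (simp add: siCov_def G_def D_def)
    finally show ?thesis .
  qed
qed

section \<open>Self sub-independence and degenerate laws\<close>

text \<open>The linear term of the expansion at 0 integrates to 0 for a centred variable, so the
  deviation of \<open>cf\<close> from 1 is of smaller order than the argument. A first moment
  suffices.\<close>

lemma cf_scaled_deviation_tendsto_0:
  fixes W :: "'a \<Rightarrow> real^'n"
  assumes W: "integrable M W" and mean: "expectation W = 0"
  shows "(\<lambda>n. 2 ^ n * cmod (cf M W ((1 / 2 ^ n) *\<^sub>R t) - 1)) \<longlonglongrightarrow> 0"
proof -
  have [measurable]: "W \<in> borel_measurable M"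
    using W by auto
  define Z where "Z \<omega> = t \<bullet> W \<omega>" for \<omega>
  have Z: "integrable M Z"
    unfolding Z_def using W by simp
  have EZ: "expectation Z = 0"
    unfolding Z_def using W mean by (simp add: integral_inner_right)
  have [measurable]: "Z \<in> borel_measurable M"
    using Z by auto
  \<comment> \<open>The rescaled first-order Taylor remainder. The quadratic bound \<open>r1\<close>
    gives pointwise convergence to 0, while the linear bound \<open>r2\<close> is uniform in
    \<open>n\<close> and integrable by the first moment alone.\<close>
  define r where "r n \<omega> = 2 ^ n * cmod (iexp (Z \<omega> / 2 ^ n) - 1 - \<i> * (Z \<omega> / 2 ^ n))" for n \<omega>
  have r1: "r n \<omega> \<le> (Z \<omega>)\<^sup>2 * (1 / 2) ^ n" for n \<omega>
  proof -
    have "cmod (iexp (Z \<omega> / 2 ^ n) - 1 - \<i> * (Z \<omega> / 2 ^ n))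
        \<le> \<bar>Z \<omega> / 2 ^ n\<bar> ^ Suc 1 / fact (Suc 1)"
      using iexp_approx1[of "Z \<omega> / 2 ^ n" 1] by (simp add: diff_diff_eq)
    also have "\<dots> \<le> (Z \<omega> / 2 ^ n)\<^sup>2"
      by (simp add: numeral_2_eq_2[symmetric] power_divide field_simps)
    finally have "r n \<omega> \<le> 2 ^ n * (Z \<omega> / 2 ^ n)\<^sup>2"
      unfolding r_def by (intro mult_left_mono) auto
    then show ?thesis
      by (simp add: power2_eq_square power_divide field_simps)
  qed
  have r2: "r n \<omega> \<le> 2 * \<bar>Z \<omega>\<bar>" for n \<omega>
  proof -
    have "cmod (iexp (Z \<omega> / 2 ^ n) - 1 - \<i> * (Z \<omega> / 2 ^ n)) \<le> 2 * \<bar>Z \<omega> / 2 ^ n\<bar>"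
      using iexp_approx2[of "Z \<omega> / 2 ^ n" 1] by (simp add: diff_diff_eq)
    then have "r n \<omega> \<le> 2 ^ n * (2 * \<bar>Z \<omega> / 2 ^ n\<bar>)"
      unfolding r_def by (intro mult_left_mono) auto
    then show ?thesis
      by simp
  qed
  have r0: "0 \<le> r n \<omega>" for n \<omega>
    by (simp add: r_def)
  have "(\<lambda>n. LINT \<omega>|M. r n \<omega>) \<longlonglongrightarrow> (LINT \<omega>|M. 0)"
  proof (rule integral_dominated_convergence[where w="\<lambda>\<omega>. 2 * \<bar>Z \<omega>\<bar>"])
    show "AE \<omega> in M. (\<lambda>n. r n \<omega>) \<longlonglongrightarrow> 0"
    proof (rule AE_I2)
      fix \<omega>
      have "(\<lambda>n. (Z \<omega>)\<^sup>2 * (1 / 2) ^ n) \<longlonglongrightarrow> 0"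
        by (intro tendsto_mult_right_zero LIMSEQ_power_zero) auto
      then show "(\<lambda>n. r n \<omega>) \<longlonglongrightarrow> 0"
        by (rule tendsto_sandwich[OF _ _ tendsto_const, rotated 2]) (auto simp: r0 r1)
    qed
  qed (use Z r0 r2 in \<open>auto simp: r_def\<close>)
  then have lim: "(\<lambda>n. LINT \<omega>|M. r n \<omega>) \<longlonglongrightarrow> 0"
    by simp
  have bound: "2 ^ n * cmod (cf M W ((1 / 2 ^ n) *\<^sub>R t) - 1) \<le> (LINT \<omega>|M. r n \<omega>)" for n
  proof -
    define Y where "Y \<omega> = Z \<omega> / 2 ^ n" for \<omega>
    have Y: "integrable M Y" "expectation Y = 0"
      unfolding Y_def using Z EZ by auto
    have int: "integrable M (\<lambda>\<omega>. iexp (Y \<omega>))"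
      and cf: "(LINT \<omega>|M. iexp (Y \<omega>)) = cf M W ((1 / 2 ^ n) *\<^sub>R t)"
      using integrable_cis_inner[of W "(1 / 2 ^ n) *\<^sub>R t"] by (auto simp: cf_def Y_def Z_def)
    \<comment> \<open>Subtracting the linear term leaves the integral unchanged because
      \<open>Y\<close> has mean zero.\<close>
    have "(LINT \<omega>|M. iexp (Y \<omega>) - 1 - \<i> * Y \<omega>) = cf M W ((1 / 2 ^ n) *\<^sub>R t) - 1"
      using int Y by (subst Bochner_Integration.integral_diff) (auto simp: cf prob_space)
    then have "(LINT \<omega>|M. iexp (Z \<omega> / 2 ^ n) - 1 - \<i> * (Z \<omega> / 2 ^ n))
        = cf M W ((1 / 2 ^ n) *\<^sub>R t) - 1"
      by (simp only: Y_def)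
    then have "cmod (cf M W ((1 / 2 ^ n) *\<^sub>R t) - 1)
        \<le> (LINT \<omega>|M. cmod (iexp (Z \<omega> / 2 ^ n) - 1 - \<i> * (Z \<omega> / 2 ^ n)))"
      using integral_norm_bound[of M "\<lambda>\<omega>. iexp (Z \<omega> / 2 ^ n) - 1 - \<i> * (Z \<omega> / 2 ^ n)"]
      by (simp only:)
    then show ?thesis
      unfolding r_def by simp
  qed
  show ?thesis
    by (rule tendsto_sandwich[OF _ _ tendsto_const lim]) (auto simp: bound)
qed

text \<open>Along \<open>t / 2 ^ n\<close> the functional equation gives \<open>cf t = cf (t / 2 ^ n) ^ (2 ^ n)\<close>,
  and \<open>cf\<close> is \<open>1 + o(1 / 2 ^ n)\<close> there because the mean vanishes.\<close>
lemma cf_eq_1_if_doubling: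
  fixes W :: "'a \<Rightarrow> real^'n"
  assumes W: "integrable M W" and mean: "expectation W = 0"
    and doubling: "\<And>t. cf M W (2 *\<^sub>R t) = (cf M W t)\<^sup>2"
  shows "cf M W t = 1"
proof -
  have [measurable]: "W \<in> borel_measurable M"
    using W by auto
  have pow: "cf M W t = cf M W ((1 / 2 ^ n) *\<^sub>R t) ^ (2 ^ n)" for n
  proof (induction n)
    case (Suc n)
    have "cf M W ((1 / 2 ^ n) *\<^sub>R t) = (cf M W ((1 / 2 ^ Suc n) *\<^sub>R t))\<^sup>2"
      using doubling[of "(1 / 2 ^ Suc n) *\<^sub>R t"] by simp
    then show ?case
      using Suc by (simp add: power_mult)
  qed simp
  \<comment> \<open>In the closed unit disc \<open>cmod (z ^ m - 1) \<le> m * cmod (z - 1)\<close>;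
    here \<open>m = 2 ^ n\<close>.\<close>
  have "cmod (cf M W t - 1) \<le> 2 ^ n * cmod (cf M W ((1 / 2 ^ n) *\<^sub>R t) - 1)" for n
    using norm_power_diff[of "cf M W ((1 / 2 ^ n) *\<^sub>R t)" 1 "2 ^ n"] norm_cf_le_1[of W]
    by (simp add: pow[of n, symmetric])
  then have "cmod (cf M W t - 1) \<le> 0"
    by (intro LIMSEQ_le_const[OF cf_scaled_deviation_tendsto_0[OF W mean, of t]]) auto
  then show ?thesis
    by simp
qed

text \<open>The real part says that the nonnegative variable
  \<open>1 - cos (t \<bullet> W \<omega>)\<close> has integral 0, so
  \<open>t \<bullet> W \<omega>\<close> is almost surely a multiple of \<open>2 * pi\<close>.
  Arbitrarily short vectors \<open>t\<close> along the axes leave only the multiple 0.\<close>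

lemma cf_eq_1_imp_AE_eq_0:
  fixes W :: "'a \<Rightarrow> real^'n"
  assumes [measurable]: "W \<in> borel_measurable M" and 1: "\<And>t. cf M W t = 1"
  shows "AE \<omega> in M. W \<omega> = 0"
proof -
  have cos: "AE \<omega> in M. cos (t \<bullet> W \<omega>) = 1" for t
  proof -
    have int: "integrable M (\<lambda>\<omega>. 1 - cos (t \<bullet> W \<omega>))"
      by (rule integrable_const_bound[where B=2])
        (auto intro!: AE_I2 simp: abs_le_iff)
    have "Re (cf M W t) = (LINT \<omega>|M. cos (t \<bullet> W \<omega>))"
      unfolding cf_def using integrable_cis_inner[of W t]
      by (subst integral_Re[symmetric]) (auto simp: Re_exp)
    moreover have "integrable M (\<lambda>\<omega>. cos (t \<bullet> W \<omega>))"
      by (rule integrable_const_bound[where B=1]) auto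
    ultimately have "(LINT \<omega>|M. 1 - cos (t \<bullet> W \<omega>)) = 0"
      by (simp add: 1 prob_space)
    then have "AE \<omega> in M. 1 - cos (t \<bullet> W \<omega>) = 0"
      using int by (subst (asm) integral_nonneg_eq_0_iff_AE) auto
    then show ?thesis
      by simp
  qed
  \<comment> \<open>Countably many test vectors allow one common exceptional null set, so that
    \<open>n\<close> may afterwards depend on \<omega>.\<close>
  have "AE \<omega> in M. \<forall>i. \<forall>n::nat. cos ((1 / real (Suc n)) *\<^sub>R axis i 1 \<bullet> W \<omega>) = 1"
    by (intro AE_all_countable[THEN iffD2] allI cos)
  then show ?thesis
  proof eventually_elim
    case (elim \<omega>)
    have "W \<omega> $ i = 0" for i
    proof -
      define x where "x = W \<omega> $ i"
      \<comment> \<open>This brings the coordinate, divided by \<open>Suc n\<close>, below 1 in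
        absolute value and hence below \<open>2 * pi\<close>.\<close>
      obtain n :: nat where n: "\<bar>x\<bar> < real (Suc n)"
        using reals_Archimedean2[of "\<bar>x\<bar>"] by (metis less_SucI of_nat_less_iff order.strict_trans lessI)
      have "cos (x / real (Suc n)) = 1"
        using elim[rule_format, of n i] by (simp add: x_def inner_axis' )
      then obtain k :: int where k: "x / real (Suc n) = of_int k * 2 * pi"
        unfolding cos_one_2pi_int by auto
      have "\<bar>x / real (Suc n)\<bar> < 1"
        using n by (simp add: field_simps)
      have "k = 0"
      proof (rule ccontr)
        assume "k \<noteq> 0"
        then have "1 * (2 * pi) \<le> \<bar>real_of_int k\<bar> * (2 * pi)"
          by (intro mult_right_mono) auto
        also have "\<dots> = \<bar>x / real (Suc n)\<bar>"
          unfolding k by (simp add: abs_mult)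
        finally show False
          using \<open>\<bar>x / real (Suc n)\<bar> < 1\<close> pi_gt3 by linarith
      qed
      with k show ?thesis
        by (simp add: x_def)
    qed
    then show ?case
      by (simp add: vec_eq_iff)
  qed
qed

text \<open>For \<open>Y = X\<close> sub-independence is the doubling equation for
  \<open>cf M X\<close>, which centring at the mean preserves. Integrability excludes laws such as
  the Cauchy law, which satisfies the doubling equation without being degenerate.\<close>

lemma sub_independent_self_iff_AE_const:
  fixes X :: "'a \<Rightarrow> real^'n"
  assumes X: "integrable M X"
  shows "sub_independent M X X \<longleftrightarrow> (AE \<omega> in M. X \<omega> = expectation X)"
proof
  have [measurable]: "X \<in> borel_measurable M"
    using X by auto
  have double: "joint_cf M X X t t = cf M X (2 *\<^sub>R t)" for t
    by (simp add: joint_cf_def cf_def mult.left_commute)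
  define m where "m = expectation X"
  define W where "W \<omega> = X \<omega> - m" for \<omega>
  have cfX: "cf M X t = exp (\<i> * complex_of_real (t \<bullet> m)) * cf M W t" for t
    unfolding cf_def W_def
    by (subst integral_mult_right_zero[symmetric])
      (simp add: inner_diff_right algebra_simps flip: exp_add)
  {
    assume "sub_independent M X X"
    then have D: "cf M X (2 *\<^sub>R t) = (cf M X t)\<^sup>2" for t
      by (simp add: sub_independent_def double power2_eq_square)
    \<comment> \<open>The phase of the mean at \<open>2 *\<^sub>R t\<close> is the square of its
      phase at \<open>t\<close>, and being nonzero it cancels.\<close>
    have "cf M W (2 *\<^sub>R t) = (cf M W t)\<^sup>2" for t
      using D[of t] unfolding cfX
      by (simp add: power_mult_distrib exp_double[symmetric] mult.left_commute)
    moreover have "integrable M W" "expectation W = 0"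
      unfolding W_def m_def using X by (auto simp: prob_space)
    ultimately have "AE \<omega> in M. W \<omega> = 0"
      by (intro cf_eq_1_imp_AE_eq_0 cf_eq_1_if_doubling) auto
    then show "AE \<omega> in M. X \<omega> = expectation X"
      by (simp add: W_def m_def)
  next
    assume "AE \<omega> in M. X \<omega> = expectation X"
    then have W0: "AE \<omega> in M. W \<omega> = 0"
      by (simp add: W_def m_def)
    have "cf M W t = (LINT \<omega>|M. 1)" for t
      unfolding cf_def by (rule integral_cong_AE) (use W0 in \<open>auto simp: W_def\<close>)
    then have "cf M W t = 1" for t
      by (simp add: prob_space)
    then show "sub_independent M X X"
      by (simp add: sub_independent_def double cfX mult.left_commute flip: exp_add)
  }
qed

end

text \<open>The scaling factor in (3) and (4) is the power \<alpha> of the absolute value of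
  \<open>b\<close>, which is that absolute value itself for \<open>\<alpha> = 1\<close>.
  Integrability in (2) gives the mean of \<open>X\<close> its meaning. Both halves of (5) are the
  equivalence in (1) taken at the exponent \<beta>.\<close>

theorem theorem2p1:
  fixes M :: "'a measure" and \<alpha> :: real
  assumes "prob_space M" and "0 < \<alpha>" and "\<alpha> < 2"
  shows
    "(\<forall>X Y :: 'a \<Rightarrow> real^'n. X \<in> borel_measurable M \<longrightarrow> Y \<in> borel_measurable M \<longrightarrow>
        0 \<le> siCov M \<alpha> X Y \<and> (siCov M \<alpha> X Y = 0 \<longleftrightarrow> sub_independent M X Y))
   \<and> (\<forall>X :: 'a \<Rightarrow> real^'n. X \<in> borel_measurable M \<longrightarrow> integrable M X \<longrightarrow>
        (siCov_self M \<alpha> X = 0 \<longleftrightarrow> (AE \<omega> in M. X \<omega> = prob_space.expectation M X)))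
   \<and> (\<forall>(X :: 'a \<Rightarrow> real^'n) (Y :: 'a \<Rightarrow> real^'n) (a1 :: real^'n) (a2 :: real^'n) (b :: real) (C :: real^'n^'n).
        X \<in> borel_measurable M \<longrightarrow> Y \<in> borel_measurable M \<longrightarrow> transpose C ** C = mat 1 \<longrightarrow>
        siCov M \<alpha> (\<lambda>\<omega>. a1 + b *\<^sub>R (C *v X \<omega>)) (\<lambda>\<omega>. a2 + b *\<^sub>R (C *v Y \<omega>))
          = ennreal (\<bar>b\<bar> powr \<alpha>) * siCov M \<alpha> X Y)
   \<and> (\<forall>(X :: 'a \<Rightarrow> real^'n) (a :: real^'n) (b :: real) (C :: real^'n^'n).
        X \<in> borel_measurable M \<longrightarrow> transpose C ** C = mat 1 \<longrightarrow>
        siCov_self M \<alpha> (\<lambda>\<omega>. a + b *\<^sub>R (C *v X \<omega>))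
          = ennreal (\<bar>b\<bar> powr \<alpha>) * siCov_self M \<alpha> X)
   \<and> (\<forall>X Y :: 'a \<Rightarrow> real^'n. X \<in> borel_measurable M \<longrightarrow> Y \<in> borel_measurable M \<longrightarrow>
        (sub_independent M X Y \<longrightarrow>
          (\<forall>\<beta>. 0 < \<beta> \<longrightarrow> \<beta> < 2 \<longrightarrow>
             integrable M (\<lambda>\<omega>. norm (X \<omega>) powr \<beta> + norm (Y \<omega>) powr \<beta>) \<longrightarrow>
             siCov M \<beta> X Y = 0))
      \<and> ((\<exists>\<beta>. 0 < \<beta> \<and> \<beta> < 2 \<and> siCov M \<beta> X Y = 0) \<longrightarrow> sub_independent M X Y))"
proof -
  interpret prob_space M by fact
  show ?thesis
    unfolding siCov_self_def
    using assms(2,3)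
    by (intro conjI allI impI)
      (auto simp: sub_independent_iff_siCov_eq_0 siCov_affine sub_independent_self_iff_AE_const)
qed

end
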